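(* Consider the following algorithm SimpleDJunta$(f,\mathcal{D},k,\epsilon)$, with oracle access to $f:\{0,1\}^n\to\{0,1\}$ and to a distribution $\mathcal{D}$ over $\{0,1\}^n$. Set $I=\emptyset$. Repeat $8(k+1)/\epsilon$ times: draw $x\sim\mathcal{D}$ (a sample, returning $f(x)$) and a uniformly random subset $R\subseteq [n]\setminus I$ (each element independently with probability $1/2$), and set $y=x^{(R)}$; if $f(x)\neq f(y)$, run the standard binary search on $(x,y)$ to obtain a pair $x',y'$ with $f(x')\ne f(y')$ and $x'=y'^{(i)}$ for some $i\in R$, and set $I=I\cup\{i\}$; if $|I|>k$, halt and reject. After all repetitions, accept. Then: (i) SimpleDJunta makes $O(k/\epsilon+k\log n)$ queries and always accepts when $f$ is a $k$-junta; (ii) it rejects with probability at least $2/3$ if $f$ is $\epsilon$-far from $k$-juntas with respect to $\mathcal{D}$.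
   Context: For $x\in\{0,1\}^n$ and $B\subseteq[n]$, $x^{(B)}$ denotes $x$ with all coordinates in $B$ flipped, and $x^{(i)}=x^{(\{i\})}$. The standard binary search on $x,y$ with $f(x)\ne f(y)$: let $B$ be such that $x=y^{(B)}$; if $|B|=1$ return $(x,y)$; otherwise split $B$ into $B_1,B_2$ of sizes $\lfloor|B|/2\rfloor,\lceil|B|/2\rceil$, query $f(x^{(B_1)})$, and recurse on $(x,x^{(B_1)})$ if $f(x)\ne f(x^{(B_1)})$ and on $(x^{(B_1)},y)$ otherwise; it uses $O(\log n)$ queries. A function is a $k$-junta if it depends on at most $k$ variables; $f$ is $\epsilon$-far from $k$-juntas with respect to $\mathcal{D}$ if $\Pr_{x\sim\mathcal{D}}[f(x)\ne g(x)]\ge\epsilon$ for every $k$-junta $g$. Queries counted are black-box evaluations of $f$ plus samples from $\mathcal{D}$. *)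

theory Defs
  imports "HOL-Probability.Probability"
begin

type_synonym point = "nat \<Rightarrow> bool"

definition cube :: "nat \<Rightarrow> point set" where
  "cube n = {1..n} \<rightarrow>\<^sub>E UNIV"

definition flip :: "point \<Rightarrow> nat set \<Rightarrow> point" where
  "flip x B = (\<lambda>i. if i \<in> B then \<not> x i else x i)"

definition depends_on :: "nat \<Rightarrow> (point \<Rightarrow> bool) \<Rightarrow> nat \<Rightarrow> bool" where
  "depends_on n f i \<longleftrightarrow> (\<exists>x\<in>cube n. f x \<noteq> f (flip x {i}))"

definition junta :: "nat \<Rightarrow> nat \<Rightarrow> (point \<Rightarrow> bool) \<Rightarrow> bool" where
  "junta n k f \<longleftrightarrow> card {i \<in> {1..n}. depends_on n f i} \<le> k"

definition far_from_juntas ::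
  "nat \<Rightarrow> nat \<Rightarrow> point pmf \<Rightarrow> real \<Rightarrow> (point \<Rightarrow> bool) \<Rightarrow> bool" where
  "far_from_juntas n k D \<epsilon> f \<longleftrightarrow>
     (\<forall>g. junta n k g \<longrightarrow> measure_pmf.prob D {x. f x \<noteq> g x} \<ge> \<epsilon>)"

text \<open>
  Oracle programs. A program mentions neither the function \<open>f\<close> nor the distribution \<open>D\<close>; these
  are supplied only by \<open>run\<close>, so a program learns about them only through \<open>Query\<close> and \<open>Sample\<close>.
  Each of those two operations costs one unit; the internal randomness \<open>Random\<close> is free.
  A sample delivers a point together with the value of \<open>f\<close> there.
\<close>

datatype 'a prog =
    Return 'a
  | Query point "bool \<Rightarrow> 'a prog"
  | Sample "point \<Rightarrow> bool \<Rightarrow> 'a prog"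
  | Random "nat set pmf" "nat set \<Rightarrow> 'a prog"

primrec bind_prog :: "'a prog \<Rightarrow> ('a \<Rightarrow> 'b prog) \<Rightarrow> 'b prog" where
  "bind_prog (Return a) h = h a"
| "bind_prog (Query x c) h = Query x (\<lambda>b. bind_prog (c b) h)"
| "bind_prog (Sample c) h = Sample (\<lambda>x b. bind_prog (c x b) h)"
| "bind_prog (Random p c) h = Random p (\<lambda>R. bind_prog (c R) h)"

text \<open>The joint distribution of the result and the number of queries.\<close>

primrec run :: "(point \<Rightarrow> bool) \<Rightarrow> point pmf \<Rightarrow> 'a prog \<Rightarrow> ('a \<times> nat) pmf" where
  "run f D (Return a) = return_pmf (a, 0)"
| "run f D (Query x c) = map_pmf (apsnd Suc) (run f D (c (f x)))"
| "run f D (Sample c) = bind_pmf D (\<lambda>x. map_pmf (apsnd Suc) (run f D (c x (f x))))"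
| "run f D (Random p c) = bind_pmf p (\<lambda>R. run f D (c R))"

definition diff_set :: "point \<Rightarrow> point \<Rightarrow> nat set" where
  "diff_set x y = {i. x i \<noteq> y i}"

datatype verdict = Accept | Reject

text \<open>
  The binary search may split a set \<open>B\<close> into halves \<open>split B\<close> and \<open>B - split B\<close> in any way,
  as long as the sizes are the prescribed ones.
\<close>

locale halving_rule =
  fixes split :: "nat set \<Rightarrow> nat set"
  assumes split_subset: "finite B \<Longrightarrow> split B \<subseteq> B"
    and card_split: "finite B \<Longrightarrow> card (split B) = card B div 2"
begin

text \<open>
  The argument \<open>fx\<close> carries the already known value of \<open>f\<close> at \<open>x\<close>; the value at \<open>y\<close> is its
  negation. The search is only started on points where \<open>f\<close> differs, so the test
  \<open>card B \<le> 1\<close> amounts to \<open>card B = 1\<close>.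
\<close>

function binary_search :: "point \<Rightarrow> bool \<Rightarrow> point \<Rightarrow> (point \<times> point) prog" where
  "binary_search x fx y =
     (let B = diff_set x y; z = flip x (split B) in
      if card B \<le> 1 then Return (x, y)
      else Query z (\<lambda>fz. if fx \<noteq> fz then binary_search x fx z else binary_search z fz y))"
  by auto

termination
proof (relation "Wellfounded.measure (\<lambda>(x, fx, y). card (diff_set x y))", goal_cases)
  case 1
  show ?case by simp
next
  case (2 x fx y B z fz)
  then have fin: "finite B" using card.infinite by fastforce
  have "diff_set x z = split B" using 2 by (auto simp: diff_set_def flip_def)
  with 2 card_split[OF fin] show ?case by simp
next
  case (3 x fx y B z fz)
  then have fin: "finite B" using card.infinite by fastforce
  have "diff_set z y = B - split B"
    using 3 split_subset[OF fin] by (auto simp: diff_set_def flip_def)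
  then have "card (diff_set z y) = card B - card B div 2"
    using split_subset[OF fin] card_split[OF fin] fin
    by (metis card_Diff_subset finite_subset)
  with 3 show ?case by simp
qed

declare binary_search.simps [simp del]

text \<open>
  The arguments of the loop are the number of remaining repetitions and the current set \<open>I\<close>.
  Drawing from the uniform distribution on the subsets of \<open>{1..n} - I\<close> is the same as including
  each element independently with probability one half.
\<close>

primrec junta_loop :: "nat \<Rightarrow> nat \<Rightarrow> nat \<Rightarrow> nat set \<Rightarrow> verdict prog" where
  "junta_loop n k 0 I = Return Accept"
| "junta_loop n k (Suc m) I =
     Sample (\<lambda>x fx.
     Random (pmf_of_set (Pow ({1..n} - I))) (\<lambda>R.
       let y = flip x R in
       Query y (\<lambda>fy.
         if fx = fy then junta_loop n k m I
         else
           bind_prog (binary_search x fx y) (\<lambda>(x', y').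
             let I' = insert (THE i. x' = flip y' {i}) I in
             if card I' > k then Return Reject else junta_loop n k m I'))))"

definition simple_djunta :: "nat \<Rightarrow> nat \<Rightarrow> real \<Rightarrow> verdict prog" where
  "simple_djunta n k \<epsilon> = junta_loop n k (nat \<lceil>8 * (real k + 1) / \<epsilon>\<rceil>) {}"

end

lemma halving_rule_exists: "\<exists>split. halving_rule split"
proof -
  have "\<exists>S. finite B \<longrightarrow> S \<subseteq> B \<and> card S = card B div 2" for B :: "nat set"
    by (metis obtain_subset_with_card_n div_le_dividend)
  then show ?thesis unfolding halving_rule_def by metis
qed

end

theory Submission imports Defs begin

text \<open>
  Completeness and the query bound: every index added to \<open>I\<close> is new and is a variable \<open>f\<close> depends
  on, so at most \<open>k + 1\<close> binary searches are run, each of at most \<open>\<lceil>log 2 n\<rceil>\<close> queries.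

  Soundness: as long as \<open>card I \<le> k\<close>, let \<open>g x\<close> be the majority of \<open>f\<close> over the points agreeing
  with \<open>x\<close> on \<open>I\<close>. It is a \<open>k\<close>-junta, so \<open>f x \<noteq> g x\<close> with probability at least \<open>\<epsilon>\<close>, and then
  \<open>f x \<noteq> f (flip x R)\<close> with probability at least \<open>1 / 2\<close>; hence each repetition enlarges \<open>I\<close> with
  probability at least \<open>\<epsilon> / 2\<close>. Giving weight \<open>2 ^ (k + 1 - card I)\<close> to the state \<open>I\<close>, the
  expected weight shrinks by a factor \<open>1 - \<epsilon> / 4\<close> per repetition, so the acceptance
  probability is at most \<open>2 ^ (k + 1) * exp (- 2 * (k + 1)) \<le> 2 / exp 2 \<le> 1 / 3\<close>.
\<close>

section \<open>Flips of points and runs of composed programs\<close>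

lemma flip_empty [simp]: "flip x {} = x"
  by (simp add: flip_def)

lemma flip_flip_same [simp]: "flip (flip x B) B = x"
  by (auto simp: flip_def)

lemma diff_set_flip [simp]: "diff_set x (flip x B) = B"
  by (auto simp: diff_set_def flip_def)

lemma flip_eq_iff [simp]: "flip x B = flip x C \<longleftrightarrow> B = C"
  by (metis diff_set_flip)

lemma flip_in_cube: "x \<in> cube n \<Longrightarrow> B \<subseteq> {1..n} \<Longrightarrow> flip x B \<in> cube n"
  by (auto simp: cube_def flip_def PiE_def extensional_def)

lemma apsnd_plus_0 [simp]: "apsnd ((+) (0::nat)) = id"
  by (auto simp: fun_eq_iff)

lemma fst_comp_apsnd [simp]: "fst \<circ> apsnd h = fst"
  by (auto simp: fun_eq_iff)

lemma run_bind_prog: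
  "run f D (bind_prog p h) =
     bind_pmf (run f D p) (\<lambda>(a, q). map_pmf (apsnd ((+) q)) (run f D (h a)))"
proof (induction p)
  case (Return a)
  then show ?case by (simp add: bind_return_pmf)
next
  case (Query x c)
  then show ?case
    by (auto simp: map_bind_pmf bind_map_pmf pmf.map_comp intro!: bind_pmf_cong pmf.map_cong)
next
  case (Sample c)
  then have "run f D (bind_prog (c x b) h) =
      bind_pmf (run f D (c x b)) (\<lambda>(a, q). map_pmf (apsnd ((+) q)) (run f D (h a)))" for x b
    by blast
  then show ?case
    by (auto simp: map_bind_pmf bind_map_pmf bind_assoc_pmf pmf.map_comp
        intro!: bind_pmf_cong pmf.map_cong)
next
  case (Random p c)
  then show ?case
    by (simp add: bind_assoc_pmf)
qed

section \<open>The binary search\<close>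

context halving_rule
begin

text \<open>The search neither samples nor draws randomness, so its run is a point mass. Induction
  on the exponent \<open>t\<close> works because both halves of a set of at most
  \<open>2 ^ Suc t\<close> elements have at most \<open>2 ^ t\<close>. Writing the result as a flip
  of \<open>x\<close> by some \<open>B \<subseteq> R\<close> keeps track of where the returned pair
  lies.\<close>

lemma run_binary_search:
  assumes "f x \<noteq> f (flip x R)" "finite R" "card R \<le> 2 ^ t"
  shows "\<exists>B i q. B \<subseteq> R \<and> i \<in> R \<and> q \<le> t \<and> f (flip x B) \<noteq> f (flip (flip x B) {i}) \<and>
           run f D (binary_search x (f x) (flip x R)) =
             return_pmf ((flip x B, flip (flip x B) {i}), q)"
  using assms
proof (induction t arbitrary: x R)
  case 0
  then have "R \<noteq> {}" by auto
  with 0 obtain i where i: "R = {i}"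
    by (metis card_1_singletonE card_0_eq le_antisym less_one not_le power_0)
  then have "run f D (binary_search x (f x) (flip x R)) = return_pmf ((x, flip x {i}), 0)"
    by (subst binary_search.simps) simp
  with 0 i show ?case
    by (intro exI[of _ "{}"] exI[of _ i] exI[of _ 0]) simp
next
  case (Suc t)
  show ?case
  proof (cases "card R \<le> 1")
    case True
    have "R \<noteq> {}" using Suc.prems by auto
    with True Suc.prems(2) obtain i where i: "R = {i}"
      by (metis card_1_singletonE card_0_eq le_antisym less_one not_le)
    then have "run f D (binary_search x (f x) (flip x R)) = return_pmf ((x, flip x {i}), 0)"
      by (subst binary_search.simps) simp
    with Suc.prems i show ?thesis
      by (intro exI[of _ "{}"] exI[of _ i] exI[of _ 0]) simp
  next
    case False
    let ?S = "split R" let ?z = "flip x (split R)"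
    note S = split_subset[OF Suc.prems(2)] card_split[OF Suc.prems(2)]
    have finS: "finite ?S" using S(1) Suc.prems(2) finite_subset by blast
    \<comment> \<open>The right half of the search starts at \<open>?z\<close>; in this form its
      endpoint matches the induction hypothesis.\<close>
    have y: "flip x R = flip ?z (R - ?S)"
      using S(1) by (auto simp: flip_def)
    have c1: "card ?S \<le> 2 ^ t" using S Suc.prems(3) by simp
    have c2: "card (R - ?S) \<le> 2 ^ t"
      using S finS Suc.prems(3) by (simp add: card_Diff_subset)
    have run: "run f D (binary_search x (f x) (flip x R)) =
        map_pmf (apsnd Suc) (run f D (if f x \<noteq> f ?z then binary_search x (f x) ?z
                                       else binary_search ?z (f ?z) (flip x R)))"
      using False by (subst binary_search.simps) (simp add: Let_def)
    show ?thesis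
    proof (cases "f x \<noteq> f ?z")
      case True
      from Suc.IH[OF True finS c1] obtain B i q
        where *: "B \<subseteq> ?S" "i \<in> ?S" "q \<le> t" "f (flip x B) \<noteq> f (flip (flip x B) {i})"
          "run f D (binary_search x (f x) ?z) = return_pmf ((flip x B, flip (flip x B) {i}), q)"
        by blast
      have "run f D (binary_search x (f x) (flip x R)) =
          return_pmf ((flip x B, flip (flip x B) {i}), Suc q)"
        unfolding run using True *(5) by simp
      moreover have "B \<subseteq> R" "i \<in> R" "Suc q \<le> Suc t" using * S(1) by auto
      ultimately show ?thesis using *(4) by blast
    next
      case False
      then have "f ?z \<noteq> f (flip ?z (R - ?S))" using Suc.prems(1) y by simp
      from Suc.IH[OF this _ c2] Suc.prems(2) obtain B i q
        where *: "B \<subseteq> R - ?S" "i \<in> R - ?S" "q \<le> t"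
          "f (flip ?z B) \<noteq> f (flip (flip ?z B) {i})"
          "run f D (binary_search ?z (f ?z) (flip x R)) =
             return_pmf ((flip ?z B, flip (flip ?z B) {i}), q)"
        unfolding y by blast
      have z: "flip ?z B = flip x (?S \<union> B)" using *(1) by (auto simp: flip_def)
      have "run f D (binary_search x (f x) (flip x R)) =
          return_pmf ((flip x (?S \<union> B), flip (flip x (?S \<union> B)) {i}), Suc q)"
        unfolding run using False *(5) by (simp add: z)
      moreover have "?S \<union> B \<subseteq> R" "i \<in> R" "Suc q \<le> Suc t" using * S(1) by auto
      ultimately show ?thesis using *(4) unfolding z by blast
    qed
  qed
qed

section \<open>One repetition of the loop, and the support of its runs\<close>

lemma run_junta_loop_Suc:
  "run f D (junta_loop n k (Suc m) I) =
     bind_pmf (pair_pmf D (pmf_of_set (Pow ({1..n} - I)))) (\<lambda>(x, R).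
       map_pmf (apsnd ((+) 2))
        (if f x = f (flip x R) then run f D (junta_loop n k m I)
         else run f D (bind_prog (binary_search x (f x) (flip x R)) (\<lambda>(x', y').
             let I' = insert (THE i. x' = flip y' {i}) I in
             if card I' > k then Return Reject else junta_loop n k m I'))))"
proof -
  \<comment> \<open>The two units are the sample and the query at \<open>flip x R\<close>.\<close>
  have [simp]: "apsnd Suc \<circ> apsnd Suc = apsnd ((+) 2)" by (auto simp: fun_eq_iff)
  show ?thesis
    by (simp add: pair_pmf_def bind_assoc_pmf bind_return_pmf map_bind_pmf pmf.map_comp Let_def
        if_distrib[of "run f D"] if_distrib[of "map_pmf h" for h]
        cong: if_cong)
qed

text \<open>Once \<open>x\<close> and \<open>R\<close> are fixed the search is deterministic, so the
  continuation is that of one definite new index. The pair found witnesses that \<open>f\<close>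
  depends on it, since flipping inside \<open>{1..n}\<close> stays in the cube.\<close>

lemma run_junta_loop_found:
  assumes "f x \<noteq> f (flip x R)" "x \<in> cube n" "R \<subseteq> {1..n} - I" "n \<le> 2 ^ t"
  obtains i q where "i \<in> {1..n} - I" "depends_on n f i" "q \<le> t"
    "run f D (bind_prog (binary_search x (f x) (flip x R)) (\<lambda>(x', y').
             let I' = insert (THE i. x' = flip y' {i}) I in
             if card I' > k then Return Reject else junta_loop n k m I')) =
     map_pmf (apsnd ((+) q))
       (if card (insert i I) > k then return_pmf (Reject, 0)
        else run f D (junta_loop n k m (insert i I)))"
proof -
  have fin: "finite R" using assms(3) by (meson finite_Diff finite_atLeastAtMost finite_subset)
  have "card R \<le> card {1..n}" using assms(3) by (intro card_mono) auto
  then have "card R \<le> 2 ^ t" using assms(4) by simp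
  from run_binary_search[OF assms(1) fin this] obtain B i q
    where *: "B \<subseteq> R" "i \<in> R" "q \<le> t" "f (flip x B) \<noteq> f (flip (flip x B) {i})"
      and run: "run f D (binary_search x (f x) (flip x R)) =
        return_pmf ((flip x B, flip (flip x B) {i}), q)"
    by blast
  \<comment> \<open>Different sets flip a point to different points, so the coordinate separating
    the pair is unique.\<close>
  have the: "(THE j. flip x B = flip (flip (flip x B) {i}) {j}) = i"
  proof (rule the_equality)
    fix j assume "flip x B = flip (flip (flip x B) {i}) {j}"
    then have "flip (flip (flip x B) {i}) {i} = flip (flip (flip x B) {i}) {j}" by simp
    then show "j = i" unfolding flip_eq_iff by simp
  qed simp
  have "flip x B \<in> cube n" using assms(2,3) *(1) by (intro flip_in_cube) auto
  with *(4) have "depends_on n f i" by (auto simp: depends_on_def)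
  moreover have "i \<in> {1..n} - I" using *(2) assms(3) by auto
  ultimately show thesis
    using *(3) by (intro that[of i q]) (simp_all add: run_bind_prog run bind_return_pmf the Let_def)
qed

text \<open>Both claims rest on the invariant that \<open>I\<close> contains only variables
  \<open>f\<close> depends on: more than \<open>k\<close> of them refute \<open>junta n k f\<close>.
  For the count, each remaining repetition is charged 2 and each of the at most
  \<open>k + 1 - card I\<close> remaining searches is charged \<open>t\<close>.\<close>

lemma junta_loop_support:
  assumes "set_pmf D \<subseteq> cube n" "n \<le> 2 ^ t"
    and "I \<subseteq> {i \<in> {1..n}. depends_on n f i}" "card I \<le> k"
    and "(v, q) \<in> set_pmf (run f D (junta_loop n k m I))"
  shows "q \<le> 2 * m + (k + 1 - card I) * t \<and> (junta n k f \<longrightarrow> v = Accept)"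
  using assms(3-)
proof (induction m arbitrary: I v q)
  case 0
  then show ?case by simp
next
  case (Suc m)
  have finI: "finite I" using Suc.prems(1) by (rule finite_subset) simp
  have U: "set_pmf (pmf_of_set (Pow ({1..n} - I))) = Pow ({1..n} - I)"
    by (intro set_pmf_of_set) auto
  from Suc.prems(3) obtain x R q0 where x: "x \<in> cube n" and R: "R \<subseteq> {1..n} - I"
    and q: "q = 2 + q0"
    and mem: "(v, q0) \<in> set_pmf (if f x = f (flip x R) then run f D (junta_loop n k m I)
         else run f D (bind_prog (binary_search x (f x) (flip x R)) (\<lambda>(x', y').
             let I' = insert (THE i. x' = flip y' {i}) I in
             if card I' > k then Return Reject else junta_loop n k m I')))"
    using assms(1) unfolding run_junta_loop_Suc
    by (auto simp: U simp del: One_nat_def)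
  show ?case
  proof (cases "f x = f (flip x R)")
    case True
    with mem Suc.IH[OF Suc.prems(1,2), of v q0] q show ?thesis by simp
  next
    case False
    from run_junta_loop_found[OF False x R assms(2), where k = k and m = m and D = D]
    obtain i q1
      where i: "i \<in> {1..n} - I" "depends_on n f i" "q1 \<le> t"
      and eq: "run f D (bind_prog (binary_search x (f x) (flip x R)) (\<lambda>(x', y').
             let I' = insert (THE i. x' = flip y' {i}) I in
             if card I' > k then Return Reject else junta_loop n k m I')) =
         map_pmf (apsnd ((+) q1)) (if card (insert i I) > k then return_pmf (Reject, 0)
            else run f D (junta_loop n k m (insert i I)))"
      by blast
    have card: "card (insert i I) = Suc (card I)" using i(1) finI by simp
    have sub: "insert i I \<subseteq> {i \<in> {1..n}. depends_on n f i}" using i Suc.prems(1) by auto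
    show ?thesis
    proof (cases "card (insert i I) > k")
      case True
      from mem False True have "v = Reject" "q0 = q1" by (simp_all add: eq)
      moreover have "\<not> junta n k f"
        using card_mono[OF _ sub] True by (auto simp: junta_def)
      \<comment> \<open>As \<open>card I \<le> k\<close>, at least one search is left in the budget,
        which pays for the one that leads to rejection.\<close>
      moreover have "1 * q1 \<le> (k + 1 - card I) * t"
        using Suc.prems(2) i(3) by (intro mult_mono) auto
      ultimately show ?thesis using q by auto
    next
      case le: False
      then obtain q2 where q2: "q0 = q1 + q2"
        "(v, q2) \<in> set_pmf (run f D (junta_loop n k m (insert i I)))"
        using mem False by (auto simp: eq)
      from le Suc.IH[OF sub _ q2(2)]
      have "q2 \<le> 2 * m + (k + 1 - card (insert i I)) * t" "junta n k f \<longrightarrow> v = Accept"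
        by auto
      moreover have "k + 1 - card I = Suc (k + 1 - card (insert i I))"
        using le card by simp
      ultimately show ?thesis using q q2(1) i(3) by simp
    qed
  qed
qed

end

section \<open>Detection probability of one repetition\<close>

lemma prob_pmf_of_set_Pow:
  assumes "finite S"
  shows "measure_pmf.prob (pmf_of_set (Pow S)) {R. P R} =
    card {R \<in> Pow S. P R} / card (Pow S)"
  using assms by (subst measure_pmf_of_set) (auto simp: Int_def)

text \<open>For \<open>R\<close> uniform on the subsets of \<open>{1..n} - I\<close>,
  \<open>flip x R\<close> is uniform on the points that agree with \<open>x\<close> outside
  \<open>{1..n} - I\<close>. If \<open>f x\<close> is not the majority value there, at least half of
  all \<open>R\<close> change the value of \<open>f\<close>.\<close>

lemma prob_flip_differs:
  assumes far: "far_from_juntas n k D \<epsilon> f" and I: "I \<subseteq> {1..n}" "card I \<le> k"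
  shows "measure_pmf.prob (pair_pmf D (pmf_of_set (Pow ({1..n} - I))))
           {(x, R). f x \<noteq> f (flip x R)} \<ge> \<epsilon> / 2"
proof -
  define S where "S = {1..n} - I"
  define U where "U = pmf_of_set (Pow S)"
  have finS: "finite S" by (simp add: S_def)
  define T where "T x = {R \<in> Pow S. f (flip x R)}" for x
  \<comment> \<open>Ties go to \<open>False\<close>. Whichever value \<open>g x\<close> has, the
    opposite value is taken by at most half of the flips.\<close>
  define g where "g x \<longleftrightarrow> 2 * card (T x) > card (Pow S)" for x
  have finT: "finite (T x)" for x using finS by (simp add: T_def)
  have "card (T (flip x {i})) = card (T x)" if "i \<in> S" for x i
  proof -
    \<comment> \<open>Toggling the membership of \<open>i\<close> is an involution on
      \<open>Pow S\<close> that exchanges flips of \<open>x\<close> with flips of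
      \<open>flip x {i}\<close>.\<close>
    define s where "s R = sym_diff {i} R" for R
    have s: "s (s R) = R" "flip (flip x {i}) (s R) = flip x R"
        "flip x (s R) = flip (flip x {i}) R"
      and s_mem: "j \<in> s R \<Longrightarrow> R \<subseteq> S \<Longrightarrow> j \<in> S" for R j
      using that by (auto simp: s_def flip_def)
    show ?thesis
      by (intro bij_betw_same_card[of s] bij_betw_byWitness[where f' = s])
        (auto simp: T_def s intro: s_mem)
  qed
  then have "g (flip x {i}) = g x" if "i \<in> S" for x i
    using that by (simp add: g_def)
  then have "{i \<in> {1..n}. depends_on n g i} \<subseteq> I"
    by (auto simp: depends_on_def S_def)
  moreover have "finite I" using I(1) finite_subset by blast
  ultimately have "junta n k g"
    using I(2) unfolding junta_def by (meson card_mono le_trans)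
  with far have g: "measure_pmf.prob D {x. f x \<noteq> g x} \<ge> \<epsilon>"
    by (simp add: far_from_juntas_def)
  have half: "measure_pmf.prob U {R. f x \<noteq> f (flip x R)} \<ge> 1 / 2" if "f x \<noteq> g x" for x
  proof -
    have pos: "card (Pow S) > 0" using finS by (simp add: card_Pow)
    have compl: "{R \<in> Pow S. \<not> f (flip x R)} = Pow S - T x" by (auto simp: T_def)
    have sub: "card (T x) \<le> card (Pow S)" using finS by (intro card_mono) (auto simp: T_def)
    have "2 * card {R \<in> Pow S. f x \<noteq> f (flip x R)} \<ge> card (Pow S)"
    proof (cases "f x")
      case True
      then have "{R \<in> Pow S. f x \<noteq> f (flip x R)} = Pow S - T x" by (auto simp: T_def)
      moreover have "card (Pow S - T x) = card (Pow S) - card (T x)"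
        using finT by (intro card_Diff_subset) (auto simp: T_def)
      ultimately show ?thesis using True that sub by (simp add: g_def)
    next
      case False
      then have "{R \<in> Pow S. f x \<noteq> f (flip x R)} = T x" by (auto simp: T_def)
      with False that show ?thesis by (simp add: g_def)
    qed
    then have "real (card (Pow S)) \<le> 2 * real (card {R \<in> Pow S. f x \<noteq> f (flip x R)})"
      by linarith
    with pos show ?thesis
      unfolding U_def prob_pmf_of_set_Pow[OF finS] by (simp add: field_simps)
  qed
  have "\<epsilon> / 2 \<le> (\<integral>x. indicator {x. f x \<noteq> g x} x / 2 \<partial>D)"
    using g by simp
  also have "\<dots> \<le> (\<integral>x. measure_pmf.prob U {R. f x \<noteq> f (flip x R)} \<partial>D)"
    using half by (intro integral_mono_AE AE_pmfI measure_pmf.integrable_const_bound[where B = 1])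
      (auto simp: indicator_def)
  also have "\<dots> = measure_pmf.prob (pair_pmf D U) {(x, R). f x \<noteq> f (flip x R)}"
  proof -
    \<comment> \<open>Events become values of Boolean distributions, so that \<open>pmf_bind\<close>
      turns the product probability into an iterated integral.\<close>
    have prob: "measure_pmf.prob M {z. P z} = pmf (map_pmf P M) True" for M :: "'a pmf" and P
      by (simp add: pmf_map vimage_def)
    show ?thesis
      unfolding prob
      by (simp add: pair_pmf_def map_bind_pmf map_pmf_def[symmetric] pmf.map_comp o_def pmf_bind)
  qed
  finally show ?thesis by (simp add: U_def S_def)
qed

section \<open>Decay of the acceptance probability\<close>

context halving_rule
begin

text \<open>With \<open>A\<close> the bound for the unchanged \<open>I\<close>, a successful search
  lowers the exponent of 2 by one and so leaves at most \<open>A / 2\<close>. Averaging over the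
  event \<open>E\<close> gives \<open>A * (1 - prob E / 2)\<close>, and \<open>prob E\<close> is at
  least \<open>\<epsilon> / 2\<close>.\<close>

lemma junta_loop_accept_prob:
  assumes D: "set_pmf D \<subseteq> cube n" and far: "far_from_juntas n k D \<epsilon> f"
    and I: "I \<subseteq> {1..n}" "card I \<le> k"
  shows "pmf (map_pmf fst (run f D (junta_loop n k m I))) Accept
           \<le> 2 ^ (k + 1 - card I) * (1 - \<epsilon> / 4) ^ m"
  using I
proof (induction m arbitrary: I)
  case 0
  have "pmf (return_pmf Accept) Accept \<le> 1" by (rule pmf_le_1)
  also have "(1 :: real) \<le> 2 ^ (k + 1 - card I)" by simp
  finally show ?case by simp
next
  case (Suc m)
  define P where "P = pair_pmf D (pmf_of_set (Pow ({1..n} - I)))"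
  define E where "E = {(x, R). f x \<noteq> f (flip x R)}"
  define A :: real where "A = 2 ^ (k + 1 - card I) * (1 - \<epsilon> / 4) ^ m"
  define F where "F = (\<lambda>(x, R). pmf (map_pmf fst (
      if f x = f (flip x R) then run f D (junta_loop n k m I)
         else run f D (bind_prog (binary_search x (f x) (flip x R)) (\<lambda>(x', y').
             let I' = insert (THE i. x' = flip y' {i}) I in
             if card I' > k then Return Reject else junta_loop n k m I')))) Accept)"
  have finI: "finite I" using Suc.prems(1) finite_subset by blast
  \<comment> \<open>By the induction hypothesis \<open>A\<close> bounds a probability from above, so
    it is nonnegative whatever the sign of \<open>1 - \<epsilon> / 4\<close>.\<close>
  have A: "A \<ge> 0"
    unfolding A_def by (rule order_trans[OF pmf_nonneg Suc.IH[OF Suc.prems]])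
  have U: "set_pmf (pmf_of_set (Pow ({1..n} - I))) = Pow ({1..n} - I)"
    by (intro set_pmf_of_set) auto
  have F: "F z \<le> A - A / 2 * indicator E z" if z: "z \<in> set_pmf P" for z
  proof -
    obtain x R where [simp]: "z = (x, R)" and x: "x \<in> cube n" and R: "R \<subseteq> {1..n} - I"
      using z D by (cases z) (auto simp: P_def U simp del: One_nat_def)
    show ?thesis
    proof (cases "f x = f (flip x R)")
      case True
      then show ?thesis using Suc.IH[OF Suc.prems] by (simp add: F_def E_def A_def)
    next
      case False
      \<comment> \<open>Only the verdict matters here, so the crude exponent \<open>n\<close> serves
        as the bound on the search length.\<close>
      from less_exp[of n] have "n \<le> 2 ^ n" by simp
      from run_junta_loop_found[OF False x R this, where k = k and m = m and D = D]
      obtain i q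
        where i: "i \<in> {1..n} - I"
        and eq: "run f D (bind_prog (binary_search x (f x) (flip x R)) (\<lambda>(x', y').
               let I' = insert (THE i. x' = flip y' {i}) I in
               if card I' > k then Return Reject else junta_loop n k m I')) =
           map_pmf (apsnd ((+) q)) (if card (insert i I) > k then return_pmf (Reject, 0)
              else run f D (junta_loop n k m (insert i I)))"
        by blast
      have Fz: "F (x, R) = pmf (map_pmf fst (map_pmf (apsnd ((+) q))
          (if card (insert i I) > k then return_pmf (Reject, 0)
           else run f D (junta_loop n k m (insert i I))))) Accept"
        by (simp only: F_def case_prod_conv False if_False eq)
      have "F z \<le> A / 2"
      \<comment> \<open>If the new index triggers rejection, \<open>F z\<close> is 0.\<close>
      proof (cases "card (insert i I) > k")
        case True
        then show ?thesis using A by (simp add: Fz)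
      next
        case le: False
        have "card (insert i I) = Suc (card I)" using i finI by simp
        then have "k + 1 - card I = Suc (k + 1 - card (insert i I))" using le by simp
        then have "A / 2 = 2 ^ (k + 1 - card (insert i I)) * (1 - \<epsilon> / 4) ^ m"
          by (simp add: A_def)
        moreover have "F z = pmf (map_pmf fst (run f D (junta_loop n k m (insert i I)))) Accept"
          using le by (simp add: Fz pmf.map_comp)
        ultimately show ?thesis
          using Suc.IH[of "insert i I"] i Suc.prems(1) le by simp
      qed
      then show ?thesis using False by (simp add: E_def)
    qed
  qed
  have "pmf (map_pmf fst (run f D (junta_loop n k (Suc m) I))) Accept = (\<integral>z. F z \<partial>P)"
    unfolding run_junta_loop_Suc map_bind_pmf pmf_bind P_def F_def
    by (intro Bochner_Integration.integral_cong) (auto simp: pmf.map_comp)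
  also have "\<dots> \<le> (\<integral>z. A - A / 2 * indicator E z \<partial>P)"
  proof (intro integral_mono_AE AE_pmfI F)
    show "integrable P F"
      by (intro measure_pmf.integrable_const_bound[where B = 1])
        (auto simp: F_def pmf_nonneg pmf_le_1)
    show "integrable P (\<lambda>z. A - A / 2 * indicator E z)"
      using A by (intro measure_pmf.integrable_const_bound[where B = A])
        (auto simp: indicator_def)
  qed
  also have "\<dots> = A - A / 2 * measure_pmf.prob P E"
    by (subst Bochner_Integration.integral_diff)
      (auto intro!: integrable_real_mult_indicator)
  also have "\<dots> \<le> A - A / 2 * (\<epsilon> / 2)"
    using prob_flip_differs[OF far Suc.prems] A
    by (intro diff_left_mono mult_left_mono) (auto simp: P_def E_def)
  finally show ?case by (simp add: A_def algebra_simps)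
qed

section \<open>The guarantees with explicit constants\<close>

lemma simple_djunta_queries:
  assumes "set_pmf D \<subseteq> cube n" "0 < \<epsilon>" "\<epsilon> \<le> 1" "1 \<le> n" "1 \<le> k"
    and "(v, q) \<in> set_pmf (run f D (simple_djunta n k \<epsilon>))"
  shows "real q \<le> 40 * (real k / \<epsilon> + real k * log 2 (real n))"
proof -
  define t where "t = nat \<lceil>log 2 n\<rceil>"
  define m where "m = nat \<lceil>8 * (real k + 1) / \<epsilon>\<rceil>"
  have log: "0 \<le> log 2 n" using assms(4) by simp
  have "real n = 2 powr log 2 n" using assms(4) by simp
  also have "\<dots> \<le> 2 powr real t" unfolding t_def by (intro powr_mono) linarith+
  also have "\<dots> = real (2 ^ t)" by (simp add: powr_realpow)
  finally have n: "n \<le> 2 ^ t" by linarith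
  have t: "real t \<le> log 2 n + 1" using log unfolding t_def by linarith
  have k: "1 \<le> real k" "real k \<le> real k / \<epsilon>"
    using assms(2,3,5) by (auto simp: field_simps intro: mult_left_le)
  have "0 \<le> 8 * (real k + 1) / \<epsilon>" using assms(2) by simp
  then have "real m \<le> 8 * (real k + 1) / \<epsilon> + 1" unfolding m_def by linarith
  \<comment> \<open>Since \<open>1 \<le> k\<close>, \<open>k + 1\<close> is at most
    \<open>2 * k\<close>; the 1 from rounding up is then absorbed by \<open>k / \<epsilon>\<close>,
    giving 17.\<close>
  also have "8 * (real k + 1) / \<epsilon> \<le> 16 * (real k / \<epsilon>)"
    using assms(2) k(1) by (simp add: field_simps)
  finally have m: "real m \<le> 17 * (real k / \<epsilon>)" using k by linarith
  have "q \<le> 2 * m + (k + 1 - card ({} :: nat set)) * t"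
    using junta_loop_support[OF assms(1) n, of "{}" f k v q m] assms(6)
    by (simp add: simple_djunta_def m_def)
  then have "real q \<le> real (2 * m + (k + 1) * t)"
    by (simp only: card.empty diff_zero of_nat_le_iff)
  also have "\<dots> = 2 * real m + (real k + 1) * real t" by (simp add: algebra_simps)
  also have "(real k + 1) * real t \<le> (2 * real k) * (log 2 n + 1)"
    using k t by (intro mult_mono) auto
  also have "\<dots> = 2 * (real k * log 2 n) + 2 * real k" by (simp add: algebra_simps)
  \<comment> \<open>The 36 is 34 from the repetitions plus 2 from rounding up
    \<open>log 2 n\<close>, as \<open>2 * k \<le> 2 * (k / \<epsilon>)\<close>.\<close>
  finally have "real q \<le> 36 * (real k / \<epsilon>) + 2 * (real k * log 2 n)"
    using m k by linarith
  moreover have "0 \<le> real k * log 2 n" using log by simp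
  ultimately show ?thesis using k unfolding distrib_left by linarith
qed

lemma simple_djunta_sound:
  assumes "set_pmf D \<subseteq> cube n" "0 < \<epsilon>" "\<epsilon> \<le> 1" "far_from_juntas n k D \<epsilon> f"
  shows "pmf (map_pmf fst (run f D (simple_djunta n k \<epsilon>))) Reject \<ge> 2 / 3"
proof -
  define m where "m = nat \<lceil>8 * (real k + 1) / \<epsilon>\<rceil>"
  define V where "V = map_pmf fst (run f D (simple_djunta n k \<epsilon>))"
  \<comment> \<open>This is \<open>1 + y \<le> exp y\<close> at \<open>y = - \<epsilon> / 4\<close>;
    \<open>\<epsilon> \<le> 1\<close> keeps the base nonnegative.\<close>
  have "(1 - \<epsilon> / 4) ^ m \<le> exp (- \<epsilon> / 4) ^ m"
    using exp_ge_add_one_self[of "- \<epsilon> / 4"] assms(3) by (intro power_mono) auto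
  also have "\<dots> = exp (- (real m * \<epsilon> / 4))"
    by (simp flip: exp_of_nat_mult)
  also have "\<dots> \<le> exp (- (2 * real (k + 1)))"
  proof -
    have "8 * (real k + 1) / \<epsilon> \<le> real m" unfolding m_def by linarith
    then show ?thesis using assms(2) by (simp add: field_simps)
  qed
  also have "\<dots> = exp (-2) ^ (k + 1)"
    by (subst exp_of_nat_mult[symmetric]) (simp add: algebra_simps)
  finally have *: "(1 - \<epsilon> / 4) ^ m \<le> exp (-2) ^ (k + 1)" .
  \<comment> \<open>The quadratic Taylor bound gives \<open>exp 1 \<ge> 1 + 1 + 1 / 2\<close>, and
    the square of \<open>5 / 2\<close> exceeds 6.\<close>
  have "exp 2 \<ge> (6 :: real)"
    using exp_lower_Taylor_quadratic[of 1] power_mono[of "5 / 2" "exp 1 :: real" 2]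
    by (simp add: power2_eq_square flip: exp_add)
  then have e: "2 * exp (-2) \<le> (1 / 3 :: real)"
    by (simp add: exp_minus field_simps)
  have "pmf V Accept \<le> 2 ^ (k + 1) * (1 - \<epsilon> / 4) ^ m"
    using junta_loop_accept_prob[OF assms(1,4), of "{}" m]
    by (simp add: V_def m_def simple_djunta_def)
  also have "\<dots> \<le> 2 ^ (k + 1) * exp (-2) ^ (k + 1)"
    using * by (intro mult_left_mono) auto
  also have "\<dots> = (2 * exp (-2)) ^ (k + 1)" by (simp add: power_mult_distrib)
  also have "\<dots> \<le> (1 / 3) ^ (k + 1)" using e by (intro power_mono) auto
  also have "\<dots> \<le> (1 / 3) ^ 1" by (intro power_decreasing) auto
  finally have acc: "pmf V Accept \<le> 1 / 3" by simp
  have "set_pmf V \<subseteq> {Accept, Reject}" using verdict.exhaust by auto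
  then have "(\<Sum>v\<in>{Accept, Reject}. pmf V v) = 1"
    by (intro sum_pmf_eq_1) simp_all
  then have "pmf V Accept + pmf V Reject = 1" by simp
  with acc show ?thesis unfolding V_def by linarith
qed

lemma simple_djunta_complete:
  assumes "set_pmf D \<subseteq> cube n" "junta n k f"
    and "(v, q) \<in> set_pmf (run f D (simple_djunta n k \<epsilon>))"
  shows "v = Accept"
  using junta_loop_support[OF assms(1), of n "{}" f k v q] less_exp[of n] assms(2,3)
  by (simp add: simple_djunta_def less_imp_le)

end

theorem theorem4:
  "\<exists>C::real. \<forall>(n::nat) (k::nat) (\<epsilon>::real) (f::point \<Rightarrow> bool) (D::point pmf) split.
     halving_rule split \<longrightarrow> 0 < \<epsilon> \<longrightarrow> \<epsilon> \<le> 1 \<longrightarrow> set_pmf D \<subseteq> cube n \<longrightarrow>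
     (let outcome = run f D (halving_rule.simple_djunta split n k \<epsilon>) in
       (1 \<le> n \<longrightarrow> 1 \<le> k \<longrightarrow>
          (\<forall>(v, q) \<in> set_pmf outcome. real q \<le> C * (real k / \<epsilon> + real k * log 2 (real n)))) \<and>
       (junta n k f \<longrightarrow> (\<forall>(v, q) \<in> set_pmf outcome. v = Accept)) \<and>
       (far_from_juntas n k D \<epsilon> f \<longrightarrow> pmf (map_pmf fst outcome) Reject \<ge> 2 / 3))"
  unfolding Let_def
proof (intro exI[of _ 40] allI impI conjI ballI case_prodI2, goal_cases)
  case 1
  then show ?case using halving_rule.simple_djunta_queries by simp
next
  case 2
  then show ?case using halving_rule.simple_djunta_complete by simp
next
  case 3
  then show ?case using halving_rule.simple_djunta_sound by simp
qed

end
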